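(* If $T$ is a tree of order $n$, then $$b(T) \le \left\lceil \frac{\sqrt{12n+64}+8}{3} \right\rceil = \sqrt{4n/3} + O(1),$$ where $b(T)$ denotes the burning number of $T$.
   Context: All graphs are finite, simple and undirected. The burning process on a graph $G$ is a discrete-time process in which each vertex is either burned or unburned. In round $t=0$ all vertices are unburned. In each round $t \ge 1$, first every unburned vertex having a neighbor that was burned in an earlier round becomes burned, and then one new unburned vertex (called a source) is chosen and burned, if such a vertex is available; burned vertices stay burned. The process ends in the first round in which all vertices of $G$ are burned. The burning number $b(G)$ is the minimum, over all choices of sources, of the number of rounds needed for the process to end. *)

theory Defs
  imports Complex_Main "HOL-Library.Landau_Symbols" "Graph_Theory.Graph_Theory"
begin

text \<open>
  A finite simple undirected graph is a \<^locale>\<open>pair_graph\<close>: finitely many vertices, and a symmetric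
  irreflexive set of vertex pairs as adjacency relation. The library predicate
  \<^const>\<open>tree\<close> is unsuitable for such graphs, because every edge, traversed back and forth, is
  a \<^const>\<open>pre_digraph.cycle\<close> of length two. The cycles of the undirected graph are those of length
  at least three. Since \<^const>\<open>Digraph_Component.connected\<close> requires a vertex, trees are nonempty.
\<close>

definition undirected_tree :: "'a pair_pre_digraph \<Rightarrow> bool" where
  "undirected_tree G \<longleftrightarrow>
     pair_graph G \<and>
     Digraph_Component.connected (with_proj G) \<and>
     \<not> (\<exists>p. pre_digraph.cycle (with_proj G) p \<and> length p \<ge> 3)"

definition fire_spread :: "'a pair_pre_digraph \<Rightarrow> 'a set \<Rightarrow> 'a set" where
  "fire_spread G B = B \<union> {v \<in> pverts G. \<exists>u\<in>B. (u, v) \<in> parcs G}"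

text \<open>
  \<open>burned G s t\<close> is the set of burned vertices at the end of round \<open>t\<close>, where \<open>s t\<close> is the source
  chosen in round \<open>t \<ge> 1\<close>. The values of \<open>s\<close> at 0 and in rounds in which no unburned vertex is
  left after the spreading step are irrelevant.
\<close>

primrec burned :: "'a pair_pre_digraph \<Rightarrow> (nat \<Rightarrow> 'a) \<Rightarrow> nat \<Rightarrow> 'a set" where
  "burned G s 0 = {}"
| "burned G s (Suc t) =
     (let S = fire_spread G (burned G s t)
      in if S = pverts G then S else insert (s (Suc t)) S)"

definition valid_sources :: "'a pair_pre_digraph \<Rightarrow> (nat \<Rightarrow> 'a) \<Rightarrow> bool" where
  "valid_sources G s \<longleftrightarrow>
     (\<forall>t. fire_spread G (burned G s t) \<noteq> pverts G \<longrightarrow>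
          s (Suc t) \<in> pverts G - fire_spread G (burned G s t))"

definition burning_rounds :: "'a pair_pre_digraph \<Rightarrow> (nat \<Rightarrow> 'a) \<Rightarrow> nat" where
  "burning_rounds G s = (LEAST t. burned G s t = pverts G)"

text \<open>
  On a finite graph every process with valid sources ends, as each round before the last one burns
  at least one new vertex; so both uses of \<^const>\<open>Least\<close> range over nonempty sets.
\<close>

definition burning_number :: "'a pair_pre_digraph \<Rightarrow> nat" where
  "burning_number G = (LEAST k. \<exists>s. valid_sources G s \<and> burning_rounds G s = k)"

end

theory Submission
  imports Defs
begin

text \<open>
  It suffices to cover a rooted spanning tree with balls of the distinct radii \<open>0, \<dots>, k - 1\<close>. Let
  \<open>R\<close> be the largest unused radius. Take a lowest subtree of diameter greater than \<open>2R\<close>: two trees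
  \<open>t\<close> and \<open>u\<close> of diameter at most \<open>2R\<close> joined by an edge. Let \<open>i\<close> be least such that a ball of radius
  \<open>R\<close> and one of radius \<open>i\<close> cover both. By minimality, \<open>t\<close> and \<open>u\<close> together have at least
  \<open>2R + 2i\<close> vertices, so that one may remove either the larger of them, with the ball of radius \<open>R\<close>
  alone, or both, with that ball and any unused radius \<open>s \<ge> i\<close>. Preferring the first option for
  large \<open>i\<close> makes the quantity \<open>3((k - 1)\<^sup>2 + j\<^sup>2) - 2(k - 1)j - 8 \<Sum>M\<close>, where \<open>M\<close> is the set of the
  \<open>j\<close> used radii below \<open>k = R + 1\<close>, stay at least four times the number of vertices left. At the start this
  says that the tree has at most \<open>3(k - 1)\<^sup>2 / 4\<close> vertices.
\<close>

section \<open>Balls\<close>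

definition ball_in :: "'a rel \<Rightarrow> 'a \<Rightarrow> nat \<Rightarrow> 'a set" where
  "ball_in E c r = {x. \<exists>m\<le>r. (c, x) \<in> E ^^ m}"

lemma ball_in_center [simp]: "c \<in> ball_in E c r"
  by (auto simp: ball_in_def intro!: exI[of _ 0])

lemma ball_in_mono: "r \<le> r' \<Longrightarrow> ball_in E c r \<subseteq> ball_in E c r'"
  unfolding ball_in_def by (blast intro: le_trans)

lemma ball_in_edge: "(c, x) \<in> E \<Longrightarrow> x \<in> ball_in E c (Suc 0)"
  by (auto simp: ball_in_def intro!: exI[of _ "Suc 0"])

lemma ball_in_trans:
  assumes "x \<in> ball_in E c r" and "y \<in> ball_in E x r'" and "r + r' \<le> r''"
  shows "y \<in> ball_in E c r''"
proof -
  obtain m m' where "m \<le> r" "(c, x) \<in> E ^^ m" "m' \<le> r'" "(x, y) \<in> E ^^ m'"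
    using assms(1,2) by (auto simp: ball_in_def)
  then have "(c, y) \<in> E ^^ (m + m')" and "m + m' \<le> r''"
    using assms(3) by (auto simp: relpow_add)
  then show ?thesis
    by (auto simp: ball_in_def)
qed

lemma ball_in_sym:
  assumes "sym E" and "x \<in> ball_in E c r"
  shows "c \<in> ball_in E x r"
proof -
  have "(x, c) \<in> E ^^ m" if "(c, x) \<in> E ^^ m" for m
    using that
  proof (induction m arbitrary: x)
    case (Suc m)
    then obtain y where "(c, y) \<in> E ^^ m" "(y, x) \<in> E"
      by auto
    then show ?case
      using Suc.IH assms(1) by (meson relpow_Suc_I2 symD)
  qed auto
  then show ?thesis
    using assms(2) by (auto simp: ball_in_def)
qed

section \<open>Rooted trees in a graph\<close>

text \<open>\<open>Graft t u\<close> hangs the root of \<open>u\<close> below the root of \<open>t\<close>.\<close>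

datatype 'a rtree = Single 'a | Graft "'a rtree" "'a rtree"

primrec apex :: "'a rtree \<Rightarrow> 'a" where
  "apex (Single a) = a"
| "apex (Graft t u) = apex t"

primrec vertices :: "'a rtree \<Rightarrow> 'a set" where
  "vertices (Single a) = {a}"
| "vertices (Graft t u) = vertices t \<union> vertices u"

text \<open>Labels may repeat, so this counts with multiplicity and bounds
  \<open>card (vertices t)\<close> from above.\<close>

primrec order :: "'a rtree \<Rightarrow> nat" where
  "order (Single a) = 1"
| "order (Graft t u) = order t + order u"

primrec height :: "'a rtree \<Rightarrow> nat" where
  "height (Single a) = 0"
| "height (Graft t u) = max (height t) (Suc (height u))"

primrec diam :: "'a rtree \<Rightarrow> nat" where
  "diam (Single a) = 0"
| "diam (Graft t u) = max (max (diam t) (diam u)) (Suc (height t + height u))"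

primrec tree_in :: "'a rel \<Rightarrow> 'a rtree \<Rightarrow> bool" where
  "tree_in E (Single a) \<longleftrightarrow> True"
| "tree_in E (Graft t u) \<longleftrightarrow> tree_in E t \<and> tree_in E u \<and> (apex t, apex u) \<in> E"

text \<open>\<open>upper t n\<close> and \<open>lower t n\<close> consist of the vertices at depth less than \<open>n\<close> and at least \<open>n\<close>.\<close>

primrec upper :: "'a rtree \<Rightarrow> nat \<Rightarrow> 'a set" where
  "upper (Single a) n = (if n = 0 then {} else {a})"
| "upper (Graft t u) n = upper t n \<union> upper u (n - 1)"

primrec lower :: "'a rtree \<Rightarrow> nat \<Rightarrow> 'a set" where
  "lower (Single a) n = (if n = 0 then {a} else {})"
| "lower (Graft t u) n = lower t n \<union> lower u (n - 1)"

lemma root_in_vertices [simp]: "apex t \<in> vertices t"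
  by (induction t) auto

lemma height_less_order: "height t < order t"
  by (induction t) auto

lemma upper_Un_lower: "vertices t \<subseteq> upper t n \<union> lower t n"
proof (induction t arbitrary: n)
  case (Graft t u)
  show ?case
    using Graft.IH(1)[of n] Graft.IH(2)[of "n - 1"] by auto
qed simp

lemma upper_0 [simp]: "upper t 0 = {}"
  by (induction t) auto

lemma upper_subset: "upper t n \<subseteq> vertices t"
  by (induction t arbitrary: n) (auto split: if_splits)

lemma lower_subset: "lower t n \<subseteq> vertices t"
  by (induction t arbitrary: n) (auto split: if_splits)

lemma lower_empty: "height t < n \<Longrightarrow> lower t n = {}"
  by (induction t arbitrary: n) auto

lemma height_le_diam: "height t \<le> diam t"
  by (induction t) auto

lemma vertices_near_root:
  assumes "tree_in E t" and "x \<in> vertices t"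
  shows "x \<in> ball_in E (apex t) (height t)"
  using assms
proof (induction t)
  case (Graft t u)
  show ?case
  proof (cases "x \<in> vertices t")
    case True
    with Graft show ?thesis
      using ball_in_mono[of "height t" "height (Graft t u)" E "apex t"] by auto
  next
    case False
    with Graft have "x \<in> ball_in E (apex u) (height u)" "(apex t, apex u) \<in> E"
      by auto
    then show ?thesis
      using ball_in_trans[OF ball_in_edge, of "apex t" "apex u" E x] by auto
  qed
qed simp

lemma upper_near_root:
  assumes "tree_in E t" and "x \<in> upper t (Suc n)"
  shows "x \<in> ball_in E (apex t) n"
  using assms
proof (induction t arbitrary: n)
  case (Graft t u)
  show ?case
  proof (cases "x \<in> upper t (Suc n)")
    case True
    with Graft show ?thesis
      by auto
  next
    case False
    with Graft.prems have x: "x \<in> upper u n" "(apex t, apex u) \<in> E" "tree_in E u"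
      by auto
    then obtain n' where "n = Suc n'"
      by (cases n) auto
    with x Graft.IH(2) show ?thesis
      using ball_in_trans[OF ball_in_edge, of "apex t" "apex u" E x n' n] by auto
  qed
qed (auto split: if_splits)

lemma ball_in_via_root:
  assumes "sym E" and "tree_in E t" and "x \<in> vertices t"
    and "c \<in> ball_in E (apex t) m" and "m + height t \<le> r"
  shows "x \<in> ball_in E c r"
  using ball_in_trans[OF ball_in_sym[OF assms(1,4)] vertices_near_root[OF assms(2,3)] assms(5)] .

section \<open>Covering with one ball\<close>

text \<open>The centre is sought on the path from the root to a deepest vertex, \<open>R\<close>
  away from the latter, or at the root if the tree is no higher than \<open>R\<close>. Bounding its
  depth makes the induction across an edge possible.\<close>

lemma small_diam_center:
  assumes "sym E" and "tree_in E t" and "diam t \<le> 2 * R"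
  shows "\<exists>c \<in> ball_in E (apex t) (height t - R). vertices t \<subseteq> ball_in E c R"
  using assms(2,3)
proof (induction t)
  case (Graft t u)
  let ?T = "Graft t u" and ?p = "height t" and ?q = "Suc (height u)"
  have pq: "?p + ?q \<le> 2 * R" and edge: "(apex t, apex u) \<in> E" and
    t: "tree_in E t" and u: "tree_in E u"
    using Graft.prems by auto
  consider "height ?T \<le> R" | "R < ?p" "?q \<le> ?p" | "R < ?q" "?p < ?q"
    by fastforce
  then show ?case
  proof cases
    case 1
    then have "vertices ?T \<subseteq> ball_in E (apex ?T) R"
      using vertices_near_root[OF Graft.prems(1)] ball_in_mono[of "height ?T" R E "apex ?T"]
      by blast
    then show ?thesis
      by (meson ball_in_center)
  next
    case 2
    then obtain c where c: "c \<in> ball_in E (apex t) (?p - R)" "vertices t \<subseteq> ball_in E c R"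
      using Graft by auto
    have "x \<in> ball_in E c R" if "x \<in> vertices u" for x
      using ball_in_trans[OF ball_in_sym[OF assms(1) c(1)]
          ball_in_trans[OF ball_in_edge[OF edge] vertices_near_root[OF u that] le_refl]] pq 2
      by simp
    with c 2 show ?thesis
      by (intro bexI[of _ c]) (auto simp: max_def)
  next
    case 3
    then obtain c where c: "c \<in> ball_in E (apex u) (height u - R)" "vertices u \<subseteq> ball_in E c R"
      using Graft by auto
    have c': "c \<in> ball_in E (apex t) (?q - R)"
      using ball_in_trans[OF ball_in_edge[OF edge] c(1)] 3 by simp
    have "x \<in> ball_in E c R" if "x \<in> vertices t" for x
      using ball_in_via_root[OF assms(1) t that c'] pq 3 by simp
    with c c' 3 show ?thesis
      by (intro bexI[of _ c]) (auto simp: max_def)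
  qed
qed (intro bexI[OF _ ball_in_center], simp)

text \<open>Walk \<open>m\<close> steps towards a deepest vertex. Since more than
  \<open>R + m\<close> levels lie that way, the diameter bound makes every branch left behind short
  enough for the ball; from the centre, \<open>R\<close> further levels are reached.\<close>

lemma tall_tree_center:
  assumes "sym E" and "tree_in E t" and "diam t \<le> 2 * R" and "R + m < height t"
  shows "\<exists>c \<in> ball_in E (apex t) m. upper t (Suc (R + m)) \<subseteq> ball_in E c R"
  using assms(2-)
proof (induction t arbitrary: m)
  case (Graft t u)
  let ?T = "Graft t u" and ?p = "height t" and ?q = "Suc (height u)"
  have pq: "?p + ?q \<le> 2 * R" and edge: "(apex t, apex u) \<in> E" and
    t: "tree_in E t" and u: "tree_in E u"
    using Graft.prems by auto
  consider "m = 0" | "?q \<le> ?p" | m' where "?p < ?q" "m = Suc m'"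
    by (meson not_less not0_implies_Suc)
  then show ?case
  proof cases
    case 1
    then show ?thesis
      using upper_near_root[OF Graft.prems(1), of _ R] by (intro bexI[of _ "apex t"]) auto
  next
    case 2
    then obtain c where c: "c \<in> ball_in E (apex t) m" "upper t (Suc (R + m)) \<subseteq> ball_in E c R"
      using Graft by fastforce
    have "x \<in> ball_in E c R" if "x \<in> vertices u" for x
      using ball_in_trans[OF ball_in_sym[OF assms(1) c(1)]
          ball_in_trans[OF ball_in_edge[OF edge] vertices_near_root[OF u that] le_refl]]
        pq 2 Graft.prems(3)
      by simp
    with c show ?thesis
      using upper_subset[of u] by (intro bexI[of _ c]) auto
  next
    case 3
    then obtain c where c: "c \<in> ball_in E (apex u) m'" "upper u (Suc (R + m')) \<subseteq> ball_in E c R"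
      using Graft by fastforce
    have c': "c \<in> ball_in E (apex t) m"
      using ball_in_trans[OF ball_in_edge[OF edge] c(1)] 3 by simp
    have "x \<in> ball_in E c R" if "x \<in> vertices t" for x
      using ball_in_via_root[OF assms(1) t that c'] pq 3 Graft.prems(3) by simp
    with c c' 3 show ?thesis
      using upper_subset[of t] by (intro bexI[of _ c]) auto
  qed
qed simp

text \<open>If the ball around the vertex at distance \<open>s\<close> from a deepest vertex misses a vertex at depth
  at least \<open>n\<close>, then this vertex lies on a second long branch, and the tree is large.\<close>

lemma cover_lower_or_large:
  assumes "sym E" and "tree_in E t"
  shows "(\<exists>c \<in> ball_in E (apex t) (height t - s). lower t n \<subseteq> ball_in E c s)
    \<or> height t + n + 2 * s + 2 \<le> 2 * order t"
  using assms(2)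
proof (induction t arbitrary: n)
  case (Single a)
  show ?case
    by (intro disjI1 bexI[of _ a]) auto
next
  case (Graft t u)
  let ?T = "Graft t u" and ?p = "height t" and ?q = "Suc (height u)"
  have edge: "(apex t, apex u) \<in> E" and t: "tree_in E t" and u: "tree_in E u"
    using Graft.prems by auto
  have order: "?p + ?q + 1 \<le> order ?T"
    using height_less_order[of t] height_less_order[of u] by simp
  consider "height ?T \<le> s" | "s < ?p" "?q \<le> ?p" | "s < ?q" "?p < ?q"
    by fastforce
  then show ?case
  proof cases
    case 1
    then have "vertices ?T \<subseteq> ball_in E (apex ?T) s"
      using vertices_near_root[OF Graft.prems] ball_in_mono[of "height ?T" s E "apex ?T"]
      by blast
    then show ?thesis
      by (meson ball_in_center lower_subset subset_trans)
  next
    case 2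
    show ?thesis
    \<comment> \<open>If \<open>u\<close> reaches depth \<open>n\<close> and \<open>?p + ?q\<close>
      exceeds \<open>2 * s\<close>, the \<open>?p + ?q + 1\<close> vertices in \<open>order\<close>
      already give the size bound. Otherwise \<open>u\<close> has nothing at depth \<open>n\<close>,
      or lies wholly within \<open>s\<close> of the centre found in \<open>t\<close>.\<close>
    proof (cases "?p + n + 2 * s + 2 \<le> 2 * order t \<or> (n \<le> ?q \<and> 2 * s < ?p + ?q)")
      case True
      then show ?thesis
        using order 2 by (auto simp: max_def)
    next
      case False
      then obtain c where c: "c \<in> ball_in E (apex t) (?p - s)" "lower t n \<subseteq> ball_in E c s"
        using Graft.IH(1)[OF t, of n] by auto
      have "lower u (n - 1) \<subseteq> ball_in E c s"
      proof (cases "n \<le> ?q")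
        case True
        have "?p - s + (Suc 0 + height u) \<le> s"
          using 2 True False by linarith
        then have "x \<in> ball_in E c s" if "x \<in> vertices u" for x
          using ball_in_trans[OF ball_in_sym[OF assms(1) c(1)]
              ball_in_trans[OF ball_in_edge[OF edge] vertices_near_root[OF u that] le_refl]]
          by blast
        then show ?thesis
          using lower_subset by fast
      qed (auto simp: lower_empty)
      with c 2 show ?thesis
        by (intro disjI1 bexI[of _ c]) (auto simp: max_def)
    qed
  next
    case 3
    show ?thesis
    \<comment> \<open>Passing from \<open>u\<close> to the whole tree raises height and
      \<open>n\<close> by at most one each; the root of \<open>t\<close> pays for this.\<close>
    proof (cases "height u + (n - 1) + 2 * s + 2 \<le> 2 * order u \<or> (n \<le> ?p \<and> 2 * s < ?p + ?q)")
      case True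
      then show ?thesis
        using order 3 height_less_order[of t] by (auto simp: max_def)
    next
      case False
      then obtain c where c: "c \<in> ball_in E (apex u) (height u - s)"
          "lower u (n - 1) \<subseteq> ball_in E c s"
        using Graft.IH(2)[OF u, of "n - 1"] by auto
      have c': "c \<in> ball_in E (apex t) (?q - s)"
        using ball_in_trans[OF ball_in_edge[OF edge] c(1)] 3 by simp
      have "lower t n \<subseteq> ball_in E c s"
      proof (cases "n \<le> ?p")
        case True
        have "?q - s + ?p \<le> s"
          using 3 True False by linarith
        then have "x \<in> ball_in E c s" if "x \<in> vertices t" for x
          using ball_in_via_root[OF assms(1) t that c'] by blast
        then show ?thesis
          using lower_subset by fast
      qed (auto simp: lower_empty)
      with c c' 3 show ?thesis
        by (intro disjI1 bexI[of _ c]) (auto simp: max_def)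
    qed
  qed
qed

section \<open>Covering a critical subtree with two balls\<close>

text \<open>The critical situation: \<open>big\<close> says that a longest path through the new edge
  has more than \<open>2 * R\<close> edges, while neither side alone has diameter above
  \<open>2 * R\<close>.\<close>

context
  fixes E :: "'a rel" and t u :: "'a rtree" and R :: nat
  assumes sym: "sym E" and tree: "tree_in E (Graft t u)"
    and small: "diam t \<le> 2 * R" "diam u \<le> 2 * R"
    and big: "2 * R \<le> height t + height u"
begin

lemma t_in: "tree_in E t" and u_in: "tree_in E u" and edge: "(apex t, apex u) \<in> E"
  using tree by auto

text \<open>The centre is sought at distance \<open>R\<close> from the deepest level of
  \<open>u\<close>: inside \<open>u\<close> if \<open>R \<le> height u\<close>, else inside
  \<open>t\<close>. What remains of the radius is spent on the top of \<open>t\<close>.\<close>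

lemma cover_branch:
  "\<exists>c. vertices u \<union> upper t (2 * R - height u) \<subseteq> ball_in E c R"
proof (cases "R \<le> height u")
  case True
  obtain c where c: "c \<in> ball_in E (apex u) (height u - R)" "vertices u \<subseteq> ball_in E c R"
    using small_diam_center[OF sym u_in small(2)] by blast
  have "c \<in> ball_in E (apex t) (Suc (height u - R))"
    using ball_in_trans[OF ball_in_edge[OF edge] c(1)] by simp
  then have root_t: "apex t \<in> ball_in E c (Suc (height u - R))"
    by (rule ball_in_sym[OF sym])
  have "x \<in> ball_in E c R" if x: "x \<in> upper t (2 * R - height u)" for x
  proof -
    obtain n where n: "2 * R - height u = Suc n"
      using x by (cases "2 * R - height u") auto
    show ?thesis
      using ball_in_trans[OF root_t upper_near_root[OF t_in, of x n]] x n True by simp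
  qed
  with c show ?thesis
    by blast
next
  case False
  \<comment> \<open>At depth \<open>m\<close> in \<open>t\<close> the deepest level of
    \<open>u\<close> is exactly \<open>R\<close> away; \<open>big\<close> makes \<open>t\<close>
    higher than \<open>R + m\<close>.\<close>
  define m where "m = R - Suc (height u)"
  have m: "Suc (R + m) = 2 * R - height u" "m + Suc (height u) = R"
    using False by (auto simp: m_def)
  obtain c where c: "c \<in> ball_in E (apex t) m" "upper t (Suc (R + m)) \<subseteq> ball_in E c R"
    using tall_tree_center[OF sym t_in small(1), of m] big m by auto
  have "x \<in> ball_in E c R" if "x \<in> vertices u" for x
    using ball_in_trans[OF ball_in_sym[OF sym c(1)]
        ball_in_trans[OF ball_in_edge[OF edge] vertices_near_root[OF u_in that] le_refl]] m
    by simp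
  with c m show ?thesis
    by auto
qed

text \<open>The mirror image of \<open>cover_branch\<close>, with the edge crossed in the other
  direction.\<close>

lemma cover_trunk:
  "\<exists>c. vertices t \<union> upper u (2 * R - height t) \<subseteq> ball_in E c R"
proof (cases "R \<le> height t")
  case True
  obtain c where c: "c \<in> ball_in E (apex t) (height t - R)" "vertices t \<subseteq> ball_in E c R"
    using small_diam_center[OF sym t_in small(1)] by blast
  have root_u: "apex u \<in> ball_in E c (Suc (height t - R))"
    using ball_in_trans[OF ball_in_sym[OF sym c(1)] ball_in_edge[OF edge]] by simp
  have "x \<in> ball_in E c R" if x: "x \<in> upper u (2 * R - height t)" for x
  proof -
    obtain n where n: "2 * R - height t = Suc n"
      using x by (cases "2 * R - height t") auto
    show ?thesis
      using ball_in_trans[OF root_u upper_near_root[OF u_in, of x n]] x n True by simp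
  qed
  with c show ?thesis
    by blast
next
  case False
  define m where "m = R - Suc (height t)"
  have m: "Suc (R + m) = 2 * R - height t" "Suc m + height t = R"
    using False by (auto simp: m_def)
  obtain c where c: "c \<in> ball_in E (apex u) m" "upper u (Suc (R + m)) \<subseteq> ball_in E c R"
    using tall_tree_center[OF sym u_in small(2), of m] big m by auto
  have c': "c \<in> ball_in E (apex t) (Suc m)"
    using ball_in_trans[OF ball_in_edge[OF edge] c(1)] by simp
  have "x \<in> ball_in E c R" if "x \<in> vertices t" for x
    using ball_in_via_root[OF sym t_in that c'] m by simp
  with c m show ?thesis
    by auto
qed

text \<open>The ball of radius \<open>R\<close> may favour either side. If the other ball fails on
  the leftover both times, \<open>cover_lower_or_large\<close> bounds \<open>order t\<close> and
  \<open>order u\<close>, and the heights cancel in the sum.\<close>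

lemma two_balls_or_large:
  "(\<exists>c c'. vertices (Graft t u) \<subseteq> ball_in E c R \<union> ball_in E c' s)
    \<or> 2 * R + 2 * s + 2 \<le> order (Graft t u)"
proof (cases "\<exists>c. lower t (2 * R - height u) \<subseteq> ball_in E c s")
  case True
  then obtain c c' where "lower t (2 * R - height u) \<subseteq> ball_in E c' s"
    "vertices u \<union> upper t (2 * R - height u) \<subseteq> ball_in E c R"
    using cover_branch by blast
  then have "vertices (Graft t u) \<subseteq> ball_in E c R \<union> ball_in E c' s"
    using upper_Un_lower[of t "2 * R - height u"] by auto
  then show ?thesis
    by blast
next
  case not_t: False
  show ?thesis
  proof (cases "\<exists>c. lower u (2 * R - height t) \<subseteq> ball_in E c s")
    case True
    then obtain c c' where "lower u (2 * R - height t) \<subseteq> ball_in E c' s"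
      "vertices t \<union> upper u (2 * R - height t) \<subseteq> ball_in E c R"
      using cover_trunk by blast
    then have "vertices (Graft t u) \<subseteq> ball_in E c R \<union> ball_in E c' s"
      using upper_Un_lower[of u "2 * R - height t"] by auto
    then show ?thesis
      by blast
  next
    case False
    \<comment> \<open>This makes the truncated subtractions exact.\<close>
    have "height t \<le> 2 * R" "height u \<le> 2 * R"
      using small height_le_diam[of t] height_le_diam[of u] by auto
    then show ?thesis
      using cover_lower_or_large[OF sym t_in, of s "2 * R - height u"] not_t
        cover_lower_or_large[OF sym u_in, of s "2 * R - height t"] False
      by auto
  qed
qed

text \<open>\<open>i\<close> is the least second radius that works, so two balls with second radius
  \<open>i - 1\<close> fail and the subtree is large. The root is always kept, so that the remainder
  can take the place of the subtree in a bigger tree.\<close>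

lemma critical_subtree:
  "\<exists>i. (\<exists>T' c. tree_in E T' \<and> apex T' = apex t
          \<and> vertices (Graft t u) \<subseteq> vertices T' \<union> ball_in E c R
          \<and> order T' + R + i \<le> order (Graft t u))
     \<and> (\<forall>s\<ge>i. \<exists>T' c c'. tree_in E T' \<and> apex T' = apex t
          \<and> vertices (Graft t u) \<subseteq> vertices T' \<union> ball_in E c R \<union> ball_in E c' s
          \<and> order T' + 2 * R + 2 * i \<le> order (Graft t u) + 1)"
proof -
  define C where "C s \<longleftrightarrow> (\<exists>c c'. vertices (Graft t u) \<subseteq> ball_in E c R \<union> ball_in E c' s)" for s
  define i where "i = (LEAST s. C s)"
  obtain ct where ct: "vertices t \<subseteq> ball_in E ct R"
    using small_diam_center[OF sym t_in small(1)] by blast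
  obtain cu where cu: "vertices u \<subseteq> ball_in E cu R"
    using small_diam_center[OF sym u_in small(2)] by blast
  have "C R"
    using ct cu by (auto simp: C_def)
  then have "C i"
    unfolding i_def by (rule LeastI)
  have large: "2 * R + 2 * i \<le> order t + order u"
  proof (cases i)
    case 0
    then show ?thesis
      using big height_less_order[of t] height_less_order[of u] by simp
  next
    case (Suc s)
    then have "\<not> C s"
      unfolding i_def by (metis lessI not_less_Least)
    then show ?thesis
      using two_balls_or_large[of s] Suc by (auto simp: C_def)
  qed
  have "\<exists>T' c. tree_in E T' \<and> apex T' = apex t
      \<and> vertices (Graft t u) \<subseteq> vertices T' \<union> ball_in E c R
      \<and> order T' + R + i \<le> order (Graft t u)"
  proof (cases "R + i \<le> order u")
    case True
    then show ?thesis
      using cu t_in by (intro exI[of _ t] exI[of _ cu]) auto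
  next
    case False
    \<comment> \<open>Here \<open>t\<close> is removed except for its root, which holds
      \<open>u\<close> in place; the strict inequality \<open>order u < R + i\<close> pays for that
      vertex.\<close>
    then show ?thesis
      using ct u_in edge large by (intro exI[of _ "Graft (Single (apex t)) u"] exI[of _ ct]) auto
  qed
  moreover have "\<exists>T' c c'. tree_in E T' \<and> apex T' = apex t
      \<and> vertices (Graft t u) \<subseteq> vertices T' \<union> ball_in E c R \<union> ball_in E c' s
      \<and> order T' + 2 * R + 2 * i \<le> order (Graft t u) + 1" if "i \<le> s" for s
  proof -
    obtain c c' where "vertices (Graft t u) \<subseteq> ball_in E c R \<union> ball_in E c' i"
      using \<open>C i\<close> by (auto simp: C_def)
    with that large show ?thesis
      using ball_in_mono[OF that, of E c']
      by (intro exI[of _ "Single (apex t)"] exI[of _ c] exI[of _ c']) auto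
  qed
  ultimately show ?thesis
    by blast
qed

end

text \<open>The induction descends to a critical subtree and grafts the reduced tree back in its
  place, which the unchanged root permits.\<close>

lemma large_diam_split:
  assumes "sym E" and "tree_in E T" and "2 * R < diam T"
  shows "\<exists>i. (\<exists>T' c. tree_in E T' \<and> apex T' = apex T
          \<and> vertices T \<subseteq> vertices T' \<union> ball_in E c R
          \<and> order T' + R + i \<le> order T)
     \<and> (\<forall>s\<ge>i. \<exists>T' c c'. tree_in E T' \<and> apex T' = apex T
          \<and> vertices T \<subseteq> vertices T' \<union> ball_in E c R \<union> ball_in E c' s
          \<and> order T' + 2 * R + 2 * i \<le> order T + 1)"
    (is "\<exists>i. ?single T i \<and> (\<forall>s\<ge>i. ?pair T i s)")
  using assms(2,3)
proof (induction T)
  case (Graft t u)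
  have t: "tree_in E t" and u: "tree_in E u" and edge: "(apex t, apex u) \<in> E"
    using Graft.prems by auto
  consider "2 * R < diam t" | "2 * R < diam u" |
    "diam t \<le> 2 * R" "diam u \<le> 2 * R" "2 * R \<le> height t + height u"
    using Graft.prems by fastforce
  then show ?case
  proof cases
    case 1
    then obtain i where i: "?single t i" "\<And>s. i \<le> s \<Longrightarrow> ?pair t i s"
      using Graft.IH(1)[OF t] by blast
    have "?single (Graft t u) i"
    proof -
      obtain T' c where "tree_in E T'" "apex T' = apex t"
        "vertices t \<subseteq> vertices T' \<union> ball_in E c R" "order T' + R + i \<le> order t"
        using i(1) by blast
      then show ?thesis
        using u edge by (intro exI[of _ "Graft T' u"] exI[of _ c]) auto
    qed
    moreover have "?pair (Graft t u) i s" if s: "i \<le> s" for s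
    proof -
      obtain T' c c' where "tree_in E T'" "apex T' = apex t"
        "vertices t \<subseteq> vertices T' \<union> ball_in E c R \<union> ball_in E c' s"
        "order T' + 2 * R + 2 * i \<le> order t + 1"
        using i(2)[OF s] by blast
      then show ?thesis
        using u edge by (intro exI[of _ "Graft T' u"] exI[of _ c] exI[of _ c']) auto
    qed
    ultimately show ?thesis
      by blast
  next
    case 2
    then obtain i where i: "?single u i" "\<And>s. i \<le> s \<Longrightarrow> ?pair u i s"
      using Graft.IH(2)[OF u] by blast
    have "?single (Graft t u) i"
    proof -
      obtain T' c where "tree_in E T'" "apex T' = apex u"
        "vertices u \<subseteq> vertices T' \<union> ball_in E c R" "order T' + R + i \<le> order u"
        using i(1) by blast
      then show ?thesis
        using t edge by (intro exI[of _ "Graft t T'"] exI[of _ c]) auto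
    qed
    moreover have "?pair (Graft t u) i s" if s: "i \<le> s" for s
    proof -
      obtain T' c c' where "tree_in E T'" "apex T' = apex u"
        "vertices u \<subseteq> vertices T' \<union> ball_in E c R \<union> ball_in E c' s"
        "order T' + 2 * R + 2 * i \<le> order u + 1"
        using i(2)[OF s] by blast
      then show ?thesis
        using t edge by (intro exI[of _ "Graft t T'"] exI[of _ c] exI[of _ c']) auto
    qed
    ultimately show ?thesis
      by blast
  next
    case 3
    show ?thesis
      using critical_subtree[OF assms(1) Graft.prems(1) 3] by simp
  qed
qed simp

section \<open>Covering with distinct radii\<close>

text \<open>The radii in \<open>M\<close> are those already spent. A ball of radius \<open>R = k - 1\<close> alone lowers the
  potential on the right by at most \<open>4 * (R + i)\<close> if \<open>R - card M \<le> 2 * i\<close>. Otherwise one of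
  the \<open>card M + 1\<close> radii from \<open>i\<close> to \<open>i + card M\<close> is unspent, and the two balls lower it by at most
  \<open>4 * (2 * R + 2 * i - 1)\<close>.\<close>

lemma cover_with_distinct_radii:
  assumes "sym E" and "tree_in E T" and "M \<subseteq> {..<k}"
    and "4 * int (order T) \<le> 3 * ((int k - 1)\<^sup>2 + (int (card M))\<^sup>2)
           - 2 * (int k - 1) * int (card M) - 8 * int (\<Sum>M)"
  shows "\<exists>c. vertices T \<subseteq> (\<Union>r\<in>{..<k} - M. ball_in E (c r) r)"
  using assms(2-)
proof (induction k arbitrary: T M)
  case 0
  \<comment> \<open>With \<open>k = 0\<close> and \<open>M\<close> empty the potential is 3, too
    small for a tree with a vertex.\<close>
  then show ?case
    using height_less_order[of T] by simp
next
  case (Suc R)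
  define j where "j = card M"
  have fin: "finite M"
    using Suc.prems(2) finite_subset by blast
  have pot: "4 * int (order T) \<le> 3 * ((int R)\<^sup>2 + (int j)\<^sup>2) - 2 * int R * int j - 8 * int (\<Sum>M)"
    using Suc.prems(3) by (simp add: j_def)
  show ?case
  proof (cases "R \<in> M")
    case True
    have M': "M - {R} \<subseteq> {..<R}"
      using Suc.prems(2) by (auto simp: less_Suc_eq)
    have "0 < j"
      using True fin by (auto simp: j_def card_gt_0_iff)
    then have cardM': "int (card (M - {R})) = int j - 1"
      using True fin by (simp add: j_def)
    have sumM': "int (\<Sum>(M - {R})) = int (\<Sum>M) - int R"
      using sum.remove[OF fin True, of "\<lambda>x. x"] by simp
    \<comment> \<open>Deleting the spent radius \<open>R\<close> changes the potential by
      \<open>4 * (R + 1 - j)\<close>, which is therefore nonnegative.\<close>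
    have "j \<le> Suc R"
      using card_mono[OF _ Suc.prems(2)] by (simp add: j_def)
    then obtain c where "vertices T \<subseteq> (\<Union>r\<in>{..<R} - (M - {R}). ball_in E (c r) r)"
      using Suc.IH[OF Suc.prems(1) M'] pot unfolding cardM' sumM'
      by (auto simp: power2_eq_square algebra_simps)
    then show ?thesis
      by (intro exI[of _ c]) fastforce
  next
    case R: False
    have M: "M \<subseteq> {..<R}"
      using Suc.prems(2) R by (auto simp: less_Suc_eq)
    then have j: "j \<le> R"
      using card_mono[OF _ M] by (simp add: j_def)
    show ?thesis
    proof (cases "diam T \<le> 2 * R")
      case True
      then obtain c where "vertices T \<subseteq> ball_in E c R"
        using small_diam_center[OF assms(1) Suc.prems(1)] by blast
      then show ?thesis
        using R by (intro exI[of _ "\<lambda>_. c"]) auto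
    next
      case False
      then obtain i where
        single: "\<exists>T' c. tree_in E T' \<and> vertices T \<subseteq> vertices T' \<union> ball_in E c R
          \<and> order T' + R + i \<le> order T" and
        pair: "\<And>s. i \<le> s \<Longrightarrow> \<exists>T' c c'. tree_in E T'
          \<and> vertices T \<subseteq> vertices T' \<union> ball_in E c R \<union> ball_in E c' s
          \<and> order T' + 2 * R + 2 * i \<le> order T + 1"
        using large_diam_split[OF assms(1) Suc.prems(1), of R] by (meson not_le)
      show ?thesis
      proof (cases "R \<le> j + 2 * i")
        case True
        obtain T' c where T': "tree_in E T'" "vertices T \<subseteq> vertices T' \<union> ball_in E c R"
          "order T' + R + i \<le> order T"
          using single by blast
        \<comment> \<open>With \<open>M\<close> fixed the potential drops by
          \<open>6 * R - 2 * j - 3\<close>.\<close>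
        have "4 * int (order T') \<le> 4 * int (order T) - 6 * int R + 2 * int j"
          using T'(3) True by linarith
        with pot have "4 * int (order T') \<le> 3 * ((int R - 1)\<^sup>2 + (int j)\<^sup>2)
            - 2 * (int R - 1) * int j - 8 * int (\<Sum>M)"
          by (simp add: power2_eq_square algebra_simps)
        then obtain d where d: "vertices T' \<subseteq> (\<Union>r\<in>{..<R} - M. ball_in E (d r) r)"
          using Suc.IH[OF T'(1) M] unfolding j_def by blast
        show ?thesis
          using d T'(2) R by (intro exI[of _ "d(R := c)"]) fastforce
      next
        case False
        have "\<not> {i..i + j} \<subseteq> M"
          using card_mono[OF fin, of "{i..i + j}"] by (auto simp: j_def)
        then obtain s where s: "i \<le> s" "s \<le> i + j" "s \<notin> M"
          by (meson atLeastAtMost_iff subsetI)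
        then have "s < R"
          using False j by linarith
        obtain T' c c' where T': "tree_in E T'"
          "vertices T \<subseteq> vertices T' \<union> ball_in E c R \<union> ball_in E c' s"
          "order T' + 2 * R + 2 * i \<le> order T + 1"
          using pair[OF s(1)] by blast
        \<comment> \<open>Spending both radii lowers the potential by
          \<open>8 * (R + s - j - 1)\<close>; the term in \<open>j\<close> offsets the excess of
          \<open>s\<close> over \<open>i\<close>.\<close>
        have "4 * int (order T') \<le> 4 * int (order T) + 4 - 8 * int R - 8 * int s + 8 * int j"
          using T'(3) s by linarith
        with pot have "4 * int (order T') \<le> 3 * ((int R - 1)\<^sup>2 + (int (card (insert s M)))\<^sup>2)
            - 2 * (int R - 1) * int (card (insert s M)) - 8 * int (\<Sum>(insert s M))"
          using fin s(3) by (simp add: j_def power2_eq_square algebra_simps)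
        then obtain d where d: "vertices T' \<subseteq> (\<Union>r\<in>{..<R} - insert s M. ball_in E (d r) r)"
          using Suc.IH[OF T'(1), of "insert s M"] M \<open>s < R\<close> by auto
        show ?thesis
          using d T'(2) R s(3) \<open>s < R\<close> by (intro exI[of _ "d(R := c, s := c')"]) fastforce
      qed
    qed
  qed
qed

section \<open>Spanning trees\<close>

lemma tree_in_insert:
  assumes "tree_in E T" and "a \<in> vertices T" and "(a, b) \<in> E"
  shows "\<exists>T'. tree_in E T' \<and> apex T' = apex T \<and> vertices T' = insert b (vertices T)
    \<and> order T' = Suc (order T)"
  using assms(1,2)
proof (induction T)
  case (Single x)
  then show ?case
    using assms(3) by (intro exI[of _ "Graft (Single a) (Single b)"]) auto
next
  case (Graft t u)
  show ?case
  proof (cases "a \<in> vertices t")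
    case True
    then obtain t' where "tree_in E t'" "apex t' = apex t" "vertices t' = insert b (vertices t)"
      "order t' = Suc (order t)"
      using Graft by auto
    then show ?thesis
      using Graft.prems by (intro exI[of _ "Graft t' u"]) auto
  next
    case False
    then obtain u' where "tree_in E u'" "apex u' = apex u" "vertices u' = insert b (vertices u)"
      "order u' = Suc (order u)"
      using Graft by auto
    then show ?thesis
      using Graft.prems by (intro exI[of _ "Graft t u'"]) auto
  qed
qed

text \<open>A repetition-free tree through \<open>x\<close> of greatest order spans
  \<open>V\<close>, as an arc leaving it would extend it.\<close>

lemma spanning_tree:
  assumes "finite V" and "x \<in> V" and "E \<subseteq> V \<times> V" and "\<And>y. y \<in> V \<Longrightarrow> (x, y) \<in> E\<^sup>*"
  shows "\<exists>T. tree_in E T \<and> vertices T = V \<and> order T = card V"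
proof -
  define P where "P T \<longleftrightarrow> tree_in E T \<and> x \<in> vertices T \<and> vertices T \<subseteq> V
    \<and> order T = card (vertices T)" for T
  have "P (Single x)"
    using assms(2) by (simp add: P_def)
  moreover have "\<And>T. P T \<Longrightarrow> order T < Suc (card V)"
    using assms(1) by (auto simp: P_def less_Suc_eq_le intro: card_mono)
  ultimately obtain T where T: "P T" and max: "\<And>T'. P T' \<Longrightarrow> order T' \<le> order T"
    using ex_has_greatest_nat[of P "Single x" order "Suc (card V)"] by (metis less_imp_le)
  have "V \<subseteq> vertices T"
  proof
    fix y
    assume "y \<in> V"
    then have "(x, y) \<in> E\<^sup>*"
      by (rule assms(4))
    then show "y \<in> vertices T"
    proof (induction rule: rtrancl_induct)
      case base
      then show ?case
        using T by (simp add: P_def)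
    next
      case (step a b)
      show ?case
      proof (rule ccontr)
        assume b: "b \<notin> vertices T"
        obtain T' where T': "tree_in E T'" "vertices T' = insert b (vertices T)"
          "order T' = Suc (order T)"
          using tree_in_insert[of E T a b] T step by (auto simp: P_def)
        have "P T'"
          using T T' b step(2) assms(1,3) finite_subset[of "vertices T" V]
          by (auto simp: P_def)
        then show False
          using max[of T'] T'(3) by simp
      qed
    qed
  qed
  then show ?thesis
    using T by (auto simp: P_def)
qed

section \<open>Burning\<close>

lemma burning_number_le_rounds:
  assumes "valid_sources G s" and "burned G s k = pverts G"
  shows "burning_number G \<le> k"
proof -
  have "burning_number G \<le> burning_rounds G s"
    unfolding burning_number_def by (rule Least_le) (use assms(1) in blast)
  also have "\<dots> \<le> k"
    unfolding burning_rounds_def by (rule Least_le) (rule assms(2))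
  finally show ?thesis .
qed

text \<open>A centre that already burns when its turn comes is replaced by an arbitrary unburned vertex.\<close>

lemma valid_sources_exist:
  fixes c :: "nat \<Rightarrow> 'a"
  shows "\<exists>s. valid_sources G s \<and>
    (\<forall>t. c (Suc t) \<in> pverts G \<longrightarrow> c (Suc t) \<in> burned G s (Suc t))"
proof -
  define pick where
    "pick t S = (if c (Suc t) \<in> pverts G - S then c (Suc t) else SOME x. x \<in> pverts G - S)" for t S
  \<comment> \<open>The sources depend on the burned sets and conversely, so the burned sets are
    built first and \<open>s\<close> is read off from them.\<close>
  define B where "B = rec_nat {} (\<lambda>t B. let S = fire_spread G B
      in if S = pverts G then S else insert (pick t S) S)"
  define s where "s t = pick (t - 1) (fire_spread G (B (t - 1)))" for t
  have B_0: "B 0 = {}"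
    and B_Suc: "B (Suc t) = (let S = fire_spread G (B t)
      in if S = pverts G then S else insert (pick t S) S)" for t
    by (simp_all add: B_def)
  have burned: "burned G s t = B t" for t
    by (induction t) (simp_all add: B_0 B_Suc s_def Let_def)
  have pick: "pick t S \<in> pverts G - S" if "S \<subseteq> pverts G" "S \<noteq> pverts G" for t S
  proof -
    have "\<exists>x. x \<in> pverts G - S"
      using that by blast
    from someI_ex[OF this] show ?thesis
      by (simp add: pick_def)
  qed
  have spread: "fire_spread G S \<subseteq> pverts G" if "S \<subseteq> pverts G" for S
    using that by (auto simp: fire_spread_def)
  have subset: "B t \<subseteq> pverts G" for t
  proof (induction t)
    case (Suc t)
    then show ?case
      using spread[OF Suc] pick[of "fire_spread G (B t)" t] by (auto simp: B_Suc Let_def)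
  qed (simp add: B_0)
  have "valid_sources G s"
    using pick[OF spread[OF subset]] by (auto simp: valid_sources_def burned s_def)
  moreover have "c (Suc t) \<in> burned G s (Suc t)" if "c (Suc t) \<in> pverts G" for t
  proof -
    have "c (Suc t) \<in> B (Suc t)"
      using that by (auto simp: B_Suc Let_def pick_def)
    then show ?thesis
      by (simp only: burned)
  qed
  ultimately show ?thesis
    by blast
qed

lemma burned_subset:
  assumes "valid_sources G s"
  shows "burned G s t \<subseteq> pverts G"
proof (induction t)
  case (Suc t)
  then have "fire_spread G (burned G s t) \<subseteq> pverts G"
    by (auto simp: fire_spread_def)
  then show ?case
    using assms by (auto simp: valid_sources_def Let_def)
qed simp

lemma burned_spreads:
  assumes "parcs G \<subseteq> pverts G \<times> pverts G"
    and "c \<in> burned G s t" and "x \<in> ball_in (parcs G) c r"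
  shows "x \<in> burned G s (t + r)"
proof -
  have step: "fire_spread G (burned G s t) \<subseteq> burned G s (Suc t)" for t
    by (auto simp: Let_def)
  have "x \<in> burned G s (t + m)" if "(c, x) \<in> parcs G ^^ m" for m
    using that
  proof (induction m arbitrary: x)
    case (Suc m)
    then obtain y where "y \<in> burned G s (t + m)" "(y, x) \<in> parcs G"
      by auto
    then have "x \<in> fire_spread G (burned G s (t + m))"
      using assms(1) by (auto simp: fire_spread_def)
    then show ?case
      using step[of "t + m"] by auto
  qed (use assms(2) in simp)
  moreover have "burned G s t' \<subseteq> burned G s (t' + n)" for t' n
  proof (induction n)
    case (Suc n)
    then show ?case
      using step[of "t' + n"] by (auto simp: fire_spread_def)
  qed simp
  ultimately show ?thesis
    using assms(3) unfolding ball_in_def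
    by (smt (verit, best) le_add_diff_inverse add.assoc mem_Collect_eq subsetD)
qed

text \<open>The centre of the ball of radius \<open>r\<close> burns by round \<open>k - r\<close>,
  leaving \<open>r\<close> rounds for its fire to fill the ball.\<close>

lemma burning_number_le_cover:
  assumes arcs: "parcs G \<subseteq> pverts G \<times> pverts G"
    and cover: "pverts G \<subseteq> (\<Union>r<k. ball_in (parcs G) (c r) r)"
  shows "burning_number G \<le> k"
proof -
  obtain s where s: "valid_sources G s"
    and c: "\<And>t. c (k - Suc t) \<in> pverts G \<Longrightarrow> c (k - Suc t) \<in> burned G s (Suc t)"
    using valid_sources_exist[of G "\<lambda>t. c (k - t)"] by blast
  have "x \<in> burned G s k" if x: "x \<in> pverts G" for x
  proof -
    obtain r where r: "r < k" "x \<in> ball_in (parcs G) (c r) r"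
      using cover x by auto
    \<comment> \<open>A point outside the graph reaches only itself, so a ball that contains a
      vertex has its centre in the graph.\<close>
    then obtain m where "(c r, x) \<in> parcs G ^^ m"
      by (auto simp: ball_in_def)
    then have "c r \<in> pverts G"
      using x arcs by (cases m) (simp, metis relpow_Suc_D2 SigmaD1 subsetD)
    then have "c r \<in> burned G s (k - r)"
      using c[of "k - Suc r"] r(1) by (simp add: Suc_diff_Suc)
    from burned_spreads[OF arcs this r(2)] show ?thesis
      using r(1) by simp
  qed
  then have "burned G s k = pverts G"
    using burned_subset[OF s] by blast
  then show ?thesis
    by (rule burning_number_le_rounds[OF s])
qed

lemma burning_number_connected:
  assumes "pair_graph G" and "Digraph_Component.connected (with_proj G)"
    and "4 * int (card (pverts G)) \<le> 3 * (int k - 1)\<^sup>2"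
  shows "burning_number G \<le> k"
proof -
  interpret pair_graph G
    by fact
  have arcs: "parcs G \<subseteq> pverts G \<times> pverts G"
    using in_arcsD1 in_arcsD2 by auto
  have sym: "sym (parcs G)"
    using sym_arcs by (simp add: symmetric_def)
  \<comment> \<open>Connectedness is defined through the symmetric closure, which here adds no
    arcs.\<close>
  have "parcs (mk_symmetric (with_proj G)) = parcs G"
    using adj_mk_symmetric_eq[OF sym_arcs] by simp
  then have "pverts G \<noteq> {}"
    and reach: "\<And>u v. u \<in> pverts G \<Longrightarrow> v \<in> pverts G \<Longrightarrow> (u, v) \<in> (parcs G)\<^sup>*"
    using assms(2)
    by (auto simp: Digraph_Component.connected_def strongly_connected_def reachable_def
        dest!: rtrancl_on_rtranclI)
  then obtain x where "x \<in> pverts G"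
    by blast
  then obtain t where t: "tree_in (parcs G) t" "vertices t = pverts G"
      "order t = card (pverts G)"
    using spanning_tree[OF _ _ arcs] reach by (metis finite_verts)
  then obtain c where "pverts G \<subseteq> (\<Union>r<k. ball_in (parcs G) (c r) r)"
    using cover_with_distinct_radii[OF sym t(1), of "{}" k] assms(3) by auto
  then show ?thesis
    by (rule burning_number_le_cover[OF arcs])
qed

lemma ceiling_bound_asymptotics:
  "(\<lambda>m::nat. real_of_int \<lceil>(sqrt (12 * real m + 64) + 8) / 3\<rceil> - sqrt (4 * real m / 3))
    \<in> O(\<lambda>_. 1)"
\<comment> \<open>The 64 adds at most 8 to the root, so the difference is at most 16/3 plus 1 for
  rounding up, below 7.\<close>
proof (rule bigoI[where c = 7], rule always_eventually, rule allI)
  fix m :: nat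
  have "sqrt (4 * real m / 3) = sqrt (12 * real m / 3\<^sup>2)"
    by simp
  also have "\<dots> = sqrt (12 * real m) / 3"
    by (simp only: real_sqrt_divide real_sqrt_abs abs_numeral)
  finally have eq: "sqrt (4 * real m / 3) = sqrt (12 * real m) / 3" .
  have "sqrt (12 * real m + 64) \<le> sqrt (12 * real m) + sqrt (8\<^sup>2)"
    using sqrt_add_le_add_sqrt[of "12 * real m" "64"] by simp
  then have "sqrt (12 * real m + 64) \<le> sqrt (12 * real m) + 8"
    by simp
  moreover have "sqrt (12 * real m) \<le> sqrt (12 * real m + 64)"
    by simp
  ultimately show "norm (real_of_int \<lceil>(sqrt (12 * real m + 64) + 8) / 3\<rceil> - sqrt (4 * real m / 3))
      \<le> 7 * norm (1 :: real)"
    using le_of_int_ceiling[of "(sqrt (12 * real m + 64) + 8) / 3"]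
      of_int_ceiling_le_add_one[of "(sqrt (12 * real m + 64) + 8) / 3"]
    unfolding eq real_norm_def abs_one abs_le_iff by argo
qed

theorem theorem2:
  fixes T :: "'a pair_pre_digraph" and n :: nat
  assumes "undirected_tree T" and "card (pverts T) = n"
  shows "int (burning_number T) \<le> \<lceil>(sqrt (12 * real n + 64) + 8) / 3\<rceil>
    \<and> (\<lambda>m::nat. real_of_int \<lceil>(sqrt (12 * real m + 64) + 8) / 3\<rceil> - sqrt (4 * real m / 3))
        \<in> O(\<lambda>_. 1)"
proof
  define K where "K = \<lceil>(sqrt (12 * real n + 64) + 8) / 3\<rceil>"
  have "(sqrt (12 * real n + 64) + 8) / 3 \<le> real_of_int K"
    unfolding K_def by (rule le_of_int_ceiling)
  then have "sqrt (12 * real n + 64) \<le> 3 * real_of_int K - 8"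
    by simp
  moreover have nonneg: "0 \<le> sqrt (12 * real n + 64)"
    by simp
  ultimately have K: "0 \<le> K" and "(sqrt (12 * real n + 64))\<^sup>2 \<le> (3 * real_of_int K - 8)\<^sup>2"
    by (linarith, rule power_mono)
  then have "real_of_int (12 * int n + 64) \<le> real_of_int ((3 * K - 8)\<^sup>2)"
    by simp
  then have "12 * int n + 64 \<le> (3 * K - 8)\<^sup>2"
    by linarith
  \<comment> \<open>Expanding gives \<open>4 * n \<le> 3 * K^2 - 16 * K\<close>, at most
    \<open>3 * (K - 1)^2\<close> for nonnegative \<open>K\<close>.\<close>
  with K have "4 * int n \<le> 3 * (K - 1)\<^sup>2"
    by (simp add: power2_eq_square algebra_simps)
  then have "burning_number T \<le> nat K"
    using assms K by (intro burning_number_connected) (auto simp: undirected_tree_def)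
  with K show "int (burning_number T) \<le> \<lceil>(sqrt (12 * real n + 64) + 8) / 3\<rceil>"
    unfolding K_def[symmetric] by linarith
qed (rule ceiling_bound_asymptotics)

end
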